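(* Consider the online bipartite matching problem with replacements: a finite set $S$ of servers is given in advance, and clients arrive one at a time, each arriving client $c$ revealing all of its edges to $S$. The SAP protocol maintains a matching as follows: when a client $c$ arrives, if there is an augmenting path (with respect to the current matching) from $c$ to an unmatched server, it augments along a shortest such path (ties broken arbitrarily); otherwise it does nothing. If $n$ clients are added in total, then the SAP protocol makes at most $O(n\log^2 n)$ total replacements (changes to the matching) over the whole sequence of insertions.
   Context: An alternating path alternates between edges not in the matching and edges in the matching; an augmenting path is an alternating path starting and ending at unmatched vertices. Augmenting along a path $P$ means flipping the matched status of every edge of $P$; the number of replacements it causes is proportional to the length of $P$. *)

theory Defs
  imports Complex_Main "HOL-Library.Landau_Symbols"
begin

(* The vertices of the bipartite graph are Inl c for clients c and Inr s for servers s;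
   an edge is the two-element set of its endpoints. N c is the set of servers adjacent to c. *)

definition client_edges :: "('c \<Rightarrow> 's set) \<Rightarrow> 'c set \<Rightarrow> ('c + 's) set set" where
  "client_edges N C = {{Inl c, Inr s} | c s. c \<in> C \<and> s \<in> N c}"

fun path_edges :: "'v list \<Rightarrow> 'v set list" where
  "path_edges (u # v # p) = {u, v} # path_edges (v # p)"
| "path_edges _ = []"

definition is_path :: "'v set set \<Rightarrow> 'v list \<Rightarrow> bool" where
  "is_path E p \<longleftrightarrow> p \<noteq> [] \<and> distinct p \<and> set (path_edges p) \<subseteq> E"

definition alternating_path :: "'v set set \<Rightarrow> 'v set set \<Rightarrow> 'v list \<Rightarrow> bool" where
  "alternating_path E M p \<longleftrightarrow> is_path E p \<and>
     (\<forall>i. Suc i < length (path_edges p) \<longrightarrow>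
        (path_edges p ! i \<in> M \<longleftrightarrow> path_edges p ! Suc i \<notin> M))"

definition matched :: "'v set set \<Rightarrow> 'v \<Rightarrow> bool" where
  "matched M v \<longleftrightarrow> (\<exists>e\<in>M. v \<in> e)"

definition augmenting_path :: "'v set set \<Rightarrow> 'v set set \<Rightarrow> 'v list \<Rightarrow> bool" where
  "augmenting_path E M p \<longleftrightarrow>
     alternating_path E M p \<and> \<not> matched M (hd p) \<and> \<not> matched M (last p)"

definition augment :: "'v set set \<Rightarrow> 'v list \<Rightarrow> 'v set set" where
  "augment M p = sym_diff M (set (path_edges p))"

definition client_augmenting_path ::
    "'s set \<Rightarrow> ('c + 's) set set \<Rightarrow> ('c + 's) set set \<Rightarrow> 'c \<Rightarrow> ('c + 's) list \<Rightarrow> bool" where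
  "client_augmenting_path S E M c p \<longleftrightarrow>
     augmenting_path E M p \<and> hd p = Inl c \<and> last p \<in> Inr ` S"

(* E is the graph on all clients that have arrived so far, including c.
   The relation leaves the choice among shortest paths open: ties are broken arbitrarily. *)
definition sap_step ::
    "'s set \<Rightarrow> ('c + 's) set set \<Rightarrow> 'c \<Rightarrow> ('c + 's) set set \<Rightarrow> ('c + 's) set set \<Rightarrow> bool" where
  "sap_step S E c M M' \<longleftrightarrow>
     (if \<exists>p. client_augmenting_path S E M c p
      then \<exists>p. is_arg_min length (client_augmenting_path S E M c) p \<and> M' = augment M p
      else M' = M)"

(* M i is the matching after the first i clients of cs have been processed. *)
definition sap_run ::
    "'s set \<Rightarrow> ('c \<Rightarrow> 's set) \<Rightarrow> 'c list \<Rightarrow> (nat \<Rightarrow> ('c + 's) set set) \<Rightarrow> bool" where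
  "sap_run S N cs M \<longleftrightarrow> M 0 = {} \<and>
     (\<forall>i < length cs.
        sap_step S (client_edges N (set (take (Suc i) cs))) (cs ! i) (M i) (M (Suc i)))"

(* Every edge whose matched status changes is counted, so a step that augments along p
   contributes the number of edges of p. *)
definition total_replacements :: "(nat \<Rightarrow> 'v set set) \<Rightarrow> nat \<Rightarrow> nat" where
  "total_replacements M n = (\<Sum>i<n. card (sym_diff (M i) (M (Suc i))))"

end

theory Submission
  imports Defs "HOL-Real_Asymp.Real_Asymp"
begin

text \<open>
  Fix \<open>0 < t < 1\<close> and let \<open>X\<close> maximise \<open>|X| - t |N(X)|\<close> over the sets of currently matched clients.
  By maximality, every set \<open>K\<close> of matched clients disjoint from \<open>X\<close> satisfies
  \<open>|K| \<le> t |N(K) - N(X)|\<close>. If the arriving client \<open>c\<close> has a neighbour outside \<open>N(X)\<close>, then the layers of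
  an alternating breadth-first search from \<open>c\<close> through servers outside \<open>N(X)\<close> therefore grow by a factor
  \<open>1/t\<close>, so a free server is reached within \<open>k\<close> layers as soon as \<open>n t\<^sup>k < 1\<close>. Hence a long shortest
  augmenting path forces \<open>N(c) \<subseteq> N(X)\<close>, and then \<open>X \<union> {c}\<close> raises the maximum by one. Since the maximum
  is at most \<open>(1 - t) n\<close> by Hall's condition, taking \<open>1 - t = (ln n + 1) / k\<close> shows that at most
  \<open>n (ln n + 1) / k\<close> augmenting paths have more than \<open>2k + 1\<close> edges; summing over \<open>k\<close> gives the bound.
\<close>

section \<open>Augmenting a matching\<close>

definition matching :: "'v set set \<Rightarrow> 'v set set \<Rightarrow> bool" where
  "matching E M \<longleftrightarrow> M \<subseteq> E \<and> pairwise disjnt M"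

lemma matchingD: "matching E M \<Longrightarrow> e \<in> M \<Longrightarrow> f \<in> M \<Longrightarrow> v \<in> e \<Longrightarrow> v \<in> f \<Longrightarrow> e = f"
  unfolding matching_def pairwise_def disjnt_def by blast

lemma path_edges_subset: "e \<in> set (path_edges p) \<Longrightarrow> e \<subseteq> set p"
  by (induction p rule: path_edges.induct) auto

lemma length_path_edges: "length (path_edges p) = length p - 1"
  by (induction p rule: path_edges.induct) auto

lemma path_edges_snoc: "path_edges (p @ [u, v]) = path_edges (p @ [u]) @ [{u, v}]"
  by (induction p rule: path_edges.induct) auto

lemma path_edges_rev: "path_edges (rev p) = rev (path_edges p)"
  by (induction p rule: path_edges.induct) (auto simp: path_edges_snoc insert_commute)

lemma alternating_path_iff_successively:
  "alternating_path E M p \<longleftrightarrow>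
     is_path E p \<and> successively (\<lambda>e f. e \<in> M \<longleftrightarrow> f \<notin> M) (path_edges p)"
  unfolding alternating_path_def successively_conv_nth by blast

text \<open>Induction two edges at a time: flipping the first two edges leaves a shorter augmenting
  path for the changed matching, so \<open>M\<close> must be generalised. Distinct ends exclude the
  one-vertex path, where nothing is flipped and its vertex stays unmatched.\<close>

lemma matching_augment:
  assumes "matching E M" "augmenting_path E M p" "hd p \<noteq> last p"
  shows "matching E (augment M p) \<and>
    (\<forall>v. matched (augment M p) v \<longleftrightarrow> matched M v \<or> v = hd p \<or> v = last p)"
  using assms
proof (induction "length p" arbitrary: M p rule: less_induct)
  case less
  note mt = less.prems(1)
  have alt: "is_path E p" "successively (\<lambda>e f. e \<in> M \<longleftrightarrow> f \<notin> M) (path_edges p)"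
    and um: "\<not> matched M (hd p)" "\<not> matched M (last p)"
    using less.prems(2) by (auto simp: augmenting_path_def alternating_path_iff_successively)
  obtain u v q where p: "p = u # v # q"
    using alt(1) less.prems(3) unfolding is_path_def
    by (metis last_ConsL list.exhaust_sel)
  have E: "{u, v} \<in> E" using alt(1) by (auto simp: p is_path_def)
  have nM: "{u, v} \<notin> M" using um by (auto simp: p matched_def)
  show ?case
  proof (cases q)
    case Nil
    have "augment M p = insert {u, v} M" using nM by (auto simp: augment_def p Nil)
    moreover have "matching E (insert {u, v} M)"
      using mt um E by (auto simp: matching_def p Nil matched_def pairwise_insert disjnt_def)
    ultimately show ?thesis by (auto simp: p Nil matched_def)
  next
    case (Cons w r)
    \<comment> \<open>Here \<open>v\<close> changes its partner from \<open>w\<close> to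
      \<open>u\<close>; this frees \<open>w\<close>, and \<open>w # r\<close> becomes augmenting for
      \<open>M1\<close>.\<close>
    define M1 where "M1 = insert {u, v} (M - {{v, w}})"
    have vw: "{v, w} \<in> M" using alt(2) nM by (auto simp: p Cons)
    have dist: "distinct (u # v # w # r)" using alt(1) by (simp add: p Cons is_path_def)
    have not_uv: "x \<noteq> {u, v}" "x \<noteq> {v, w}" if "x \<in> set (path_edges (w # r))" for x
      using path_edges_subset[OF that] dist by auto
    have same: "x \<in> M1 \<longleftrightarrow> x \<in> M" if "x \<in> set (path_edges (w # r))" for x
      using not_uv[OF that] by (auto simp: M1_def)
    have only_v: "e = {v, w}" if "e \<in> M" "v \<in> e \<or> w \<in> e" for e
      using matchingD[OF mt that(1) vw] that(2) by auto
    have mt1: "matching E M1"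
      using mt um(1) E only_v
      by (auto simp: matching_def M1_def p matched_def pairwise_def disjnt_def)
    have m1: "matched M1 x \<longleftrightarrow> matched M x \<and> x \<noteq> w \<or> x = u" for x
    proof -
      have "(\<exists>e\<in>M - {{v, w}}. x \<in> e) \<longleftrightarrow> matched M x \<and> x \<noteq> v \<and> x \<noteq> w"
        using only_v unfolding matched_def by blast
      moreover have "matched M v" using vw unfolding matched_def by blast
      ultimately show ?thesis using dist unfolding matched_def M1_def by auto
    qed
    have r: "r \<noteq> []" using um(2) vw by (auto simp: p Cons matched_def)
    have "last (w # r) \<noteq> u" "last (w # r) \<noteq> w"
      using dist r last_in_set[OF r] by auto
    moreover have "last p = last (w # r)" by (simp add: p Cons)
    moreover have "successively (\<lambda>e f. e \<in> M1 \<longleftrightarrow> f \<notin> M1) (path_edges (w # r))"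
    proof -
      have "successively (\<lambda>e f. e \<in> M \<longleftrightarrow> f \<notin> M) (path_edges (w # r))"
        using alt(2) by (cases r) (auto simp: p Cons successively_Cons)
      then show ?thesis
        by (rule successively_mono) (use same in auto)
    qed
    ultimately have "augmenting_path E M1 (w # r)" "hd (w # r) \<noteq> last (w # r)"
      using alt(1) um m1 dist
      by (auto simp: augmenting_path_def alternating_path_iff_successively is_path_def p Cons
          simp del: last.simps)
    from less.hyps[OF _ mt1 this]
    have IH: "matching E (augment M1 (w # r))"
      "matched (augment M1 (w # r)) x \<longleftrightarrow> matched M1 x \<or> x = w \<or> x = last (w # r)" for x
      by (auto simp: p Cons)
    have "augment M p = augment M1 (w # r)"
      using not_uv nM vw by (auto simp: augment_def p Cons M1_def)
    moreover have "matched M w" using vw by (auto simp: matched_def)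
    ultimately show ?thesis using IH m1 by (auto simp: p Cons)
  qed
qed

section \<open>Alternating search from an arriving client\<close>

text \<open>Alternating paths from client \<open>c\<close> to a server, listed from the server back to \<open>c\<close>.\<close>

inductive rev_alt_path ::
    "('c \<Rightarrow> 's set) \<Rightarrow> ('c + 's) set set \<Rightarrow> 'c \<Rightarrow> ('c + 's) list \<Rightarrow> bool"
  for N M c where
  base: "s \<in> N c \<Longrightarrow> rev_alt_path N M c [Inr s, Inl c]"
| step: "rev_alt_path N M c (Inr s' # p) \<Longrightarrow> {Inl d, Inr s'} \<in> M \<Longrightarrow> s \<in> N d \<Longrightarrow>
    Inr s \<notin> set (Inr s' # p) \<Longrightarrow> rev_alt_path N M c (Inr s # Inl d # Inr s' # p)"

text \<open>A suffix starting at a server is again such a path. Cutting back to it deals with a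
  search that returns to a server already on its path.\<close>

lemma rev_alt_path_truncate:
  assumes "rev_alt_path N M c p" "Inr s \<in> set p"
  shows "\<exists>q. rev_alt_path N M c (Inr s # q) \<and> length (Inr s # q) \<le> length p"
  using assms
proof induction
  case (base s')
  then show ?case by (auto intro: rev_alt_path.base)
next
  case (step s' p d s'')
  show ?case
  proof (cases "s = s''")
    case True
    then show ?thesis using rev_alt_path.step[OF step.hyps] by auto
  next
    case False
    then have "Inr s \<in> set (Inr s' # p)" using step.prems by auto
    from step.IH[OF this] show ?thesis by auto
  qed
qed

text \<open>The last two conjuncts carry the induction. The newest edge lies outside
  \<open>M\<close>, which keeps the alternation going. Every client except \<open>c\<close> has its
  partner behind the head, so a client matched to the head server cannot have occurred
  before.\<close>

lemma rev_alt_path_sound: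
  assumes "rev_alt_path N M c p" "matching (client_edges N C) M" "c \<in> C" "\<not> matched M (Inl c)"
  shows "distinct p \<and> last p = Inl c \<and> p \<noteq> [] \<and> set (path_edges p) \<subseteq> client_edges N C \<and>
    successively (\<lambda>e f. e \<in> M \<longleftrightarrow> f \<notin> M) (path_edges p) \<and>
    (\<exists>e es. path_edges p = e # es \<and> e \<notin> M) \<and>
    (\<forall>d. Inl d \<in> set p \<longrightarrow> d = c \<or> (\<exists>s. {Inl d, Inr s} \<in> M \<and> Inr s \<in> set (tl p)))"
  using assms(1)
proof induction
  case (base s)
  then show ?case using assms(3,4) by (auto simp: client_edges_def matched_def)
next
  case (step s' p d s)
  note mt = assms(2)
  have d: "d \<in> C" "s' \<in> N d" using step.hyps(2) mt
    by (auto simp: matching_def client_edges_def doubleton_eq_iff)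
  have "d \<noteq> c" using step.hyps(2) assms(4) by (auto simp: matched_def)
  have "Inl d \<notin> set p"
  proof
    assume "Inl d \<in> set p"
    then obtain s2 where "{Inl d, Inr s2} \<in> M" "Inr s2 \<in> set p"
      using step.IH \<open>d \<noteq> c\<close> by auto
    with matchingD[OF mt this(1) step.hyps(2), of "Inl d"] step.IH show False
      by (auto simp: doubleton_eq_iff)
  qed
  moreover have "{Inr s, Inl d} \<notin> M"
    using matchingD[OF mt _ step.hyps(2), of "{Inr s, Inl d}" "Inl d"] step.hyps(4)
    by (auto simp: doubleton_eq_iff)
  moreover have "{Inr s, Inl d} \<in> client_edges N C" "{Inl d, Inr s'} \<in> client_edges N C"
    using d step.hyps(3) by (auto simp: client_edges_def)
  ultimately show ?case
    using step.IH step.hyps by (auto simp: insert_commute)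
qed

text \<open>Earlier layers are not removed: if \<open>M\<close> is a matching of the graph, a
  matched server recurs in the next layer as a neighbour of its own partner. This suits an expansion
  bound that counts all of N(K) - T.\<close>

fun server_layer :: "('c \<Rightarrow> 's set) \<Rightarrow> ('c + 's) set set \<Rightarrow> 's set \<Rightarrow> 'c \<Rightarrow> nat \<Rightarrow> 's set" where
  "server_layer N M T c 0 = N c - T"
| "server_layer N M T c (Suc i) =
     \<Union> (N ` {d. \<exists>s \<in> server_layer N M T c i. {Inl d, Inr s} \<in> M}) - T"

text \<open>Layer 0 needs two vertices, and each further layer adds one client and one server,
  unless the server is already on the path and truncation applies.\<close>

lemma rev_alt_path_server_layer:
  assumes "s \<in> server_layer N M T c i"
  shows "\<exists>q. rev_alt_path N M c (Inr s # q) \<and> length (Inr s # q) \<le> 2 * i + 2"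
  using assms
proof (induction i arbitrary: s)
  case 0
  then show ?case using rev_alt_path.base[of s N c M] by auto
next
  case (Suc i)
  then obtain d s' where d: "s' \<in> server_layer N M T c i" "{Inl d, Inr s'} \<in> M" "s \<in> N d"
    by auto
  from Suc.IH[OF d(1)] obtain q where
    q: "rev_alt_path N M c (Inr s' # q)" "length (Inr s' # q) \<le> 2 * i + 2" by blast
  show ?case
  proof (cases "Inr s \<in> set (Inr s' # q)")
    case True
    from rev_alt_path_truncate[OF q(1) this] q(2) show ?thesis by fastforce
  next
    case False
    from rev_alt_path.step[OF q(1) d(2,3) this] q(2) show ?thesis by (intro exI) auto
  qed
qed

text \<open>If layers 0 to \<open>k\<close> held only matched servers, applying
  \<open>expand\<close> to their partners would make layer \<open>k\<close> larger than
  \<open>card C\<close>, although its servers have distinct partners in \<open>C\<close>. The set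
  \<open>T\<close> stands for N(X).\<close>

lemma short_client_augmenting_path:
  fixes t :: real
  assumes mt: "matching (client_edges N C) M" and "finite C" and c: "c \<in> C" "\<not> matched M (Inl c)"
    and NS: "\<And>d. d \<in> C \<Longrightarrow> N d \<subseteq> S" and "finite S"
    and t: "0 < t" "real (card C) * t ^ k < 1"
    and nonempty: "\<not> N c \<subseteq> T"
    and expand: "\<And>K. K \<subseteq> {d. matched M (Inl d)} \<Longrightarrow> (\<And>d. d \<in> K \<Longrightarrow> \<not> N d \<subseteq> T) \<Longrightarrow>
      real (card K) \<le> t * real (card (\<Union> (N ` K) - T))"
  shows "\<exists>p. client_augmenting_path S (client_edges N C) M c p \<and> length p \<le> 2 * k + 2"
proof -
  let ?L = "server_layer N M T c"
  have in_C: "d \<in> C \<and> s \<in> N d" if "{Inl d, Inr s} \<in> M" for d s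
    using that mt by (auto simp: matching_def client_edges_def doubleton_eq_iff)
  have partner: "\<exists>d. {Inl d, Inr s} \<in> M" if "matched M (Inr s)" for s
  proof -
    obtain e where e: "e \<in> M" "Inr s \<in> e" using \<open>matched M (Inr s)\<close> by (auto simp: matched_def)
    then show ?thesis using mt by (auto simp: matching_def client_edges_def)
  qed
  have LS: "?L i \<subseteq> S" for i
    using in_C NS c by (cases i) fastforce+
  have fin: "finite (?L i)" for i using LS \<open>finite S\<close> finite_subset by blast
  have le: "card (?L i) \<le> card {d. \<exists>s \<in> ?L i. {Inl d, Inr s} \<in> M}"
    if all: "\<forall>s \<in> ?L i. matched M (Inr s)" for i
  proof -
    obtain g where g: "\<And>s. s \<in> ?L i \<Longrightarrow> {Inl (g s), Inr s} \<in> M"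
      using all partner by metis
    have "inj_on g (?L i)"
    proof
      fix x y assume "x \<in> ?L i" "y \<in> ?L i" "g x = g y"
      then show "x = y" using matchingD[OF mt g g, of x y "Inl (g x)"]
        by (auto simp: doubleton_eq_iff)
    qed
    moreover have "finite {d. \<exists>s \<in> ?L i. {Inl d, Inr s} \<in> M}"
      by (rule finite_subset[OF _ \<open>finite C\<close>]) (use in_C in auto)
    ultimately show ?thesis by (intro card_inj_on_le[of g]) (use g in auto)
  qed
  have "\<exists>i \<le> k. \<exists>s \<in> ?L i. \<not> matched M (Inr s)"
  proof (rule ccontr)
    assume "\<not> ?thesis"
    then have all: "\<forall>s \<in> ?L i. matched M (Inr s)" if "i \<le> k" for i using that by blast
    have grow: "1 \<le> real (card (?L i)) * t ^ i" if "i \<le> k" for i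
      using that
    proof (induction i)
      case 0
      have "?L 0 \<noteq> {}" using nonempty by auto
      then have "card (?L 0) \<ge> 1" using fin[of 0] by (simp add: card_gt_0_iff Suc_le_eq)
      then show ?case by simp
    next
      case (Suc i)
      let ?K = "{d. \<exists>s \<in> ?L i. {Inl d, Inr s} \<in> M}"
      \<comment> \<open>Partners of layer \<open>i\<close> thus have a neighbour outside
        \<open>T\<close>, as \<open>expand\<close> requires.\<close>
      have LT: "?L i \<inter> T = {}" by (cases i) auto
      have "real (card (?L i)) \<le> real (card ?K)" using le[OF all] Suc.prems by simp
      also have "\<dots> \<le> t * real (card (\<Union> (N ` ?K) - T))"
        by (rule expand) (use in_C LT in \<open>auto simp: matched_def\<close>)
      also have "\<dots> = t * real (card (?L (Suc i)))" by simp
      finally have "real (card (?L i)) * t ^ i \<le> t * real (card (?L (Suc i))) * t ^ i"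
        using t(1) by (intro mult_right_mono) auto
      then show ?case using Suc by (simp add: mult_ac)
    qed
    have "card {d. \<exists>s \<in> ?L k. {Inl d, Inr s} \<in> M} \<le> card C"
      by (rule card_mono[OF \<open>finite C\<close>]) (use in_C in auto)
    then have "real (card (?L k)) * t ^ k \<le> real (card C) * t ^ k"
      using le[OF all, of k] t(1) by (intro mult_right_mono) auto
    then show False using grow[of k] t(2) by linarith
  qed
  then obtain i s where i: "i \<le> k" "s \<in> ?L i" "\<not> matched M (Inr s)" by blast
  from rev_alt_path_server_layer[OF i(2)] obtain q where
    q: "rev_alt_path N M c (Inr s # q)" "length (Inr s # q) \<le> 2 * i + 2" by blast
  let ?p = "rev (Inr s # q)"
  note sound = rev_alt_path_sound[OF q(1) mt c]
  \<comment> \<open>Reversal swaps the arguments of the relation, which is symmetric.\<close>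
  have "successively (\<lambda>e f. e \<in> M \<longleftrightarrow> f \<notin> M) (path_edges ?p)"
    unfolding path_edges_rev successively_rev
    by (rule successively_mono[of "\<lambda>e f. e \<in> M \<longleftrightarrow> f \<notin> M"]) (use sound in auto)
  then have "client_augmenting_path S (client_edges N C) M c ?p"
    using sound i LS[of i] c(2)
    unfolding client_augmenting_path_def augmenting_path_def alternating_path_iff_successively
      is_path_def path_edges_rev
    by (auto simp: hd_rev last_rev simp del: rev.simps)
  then show ?thesis using q(2) i(1) by (intro exI[of _ ?p]) auto
qed

section \<open>Counting long augmenting paths\<close>

locale sap =
  fixes S :: "'s set" and N :: "'c \<Rightarrow> 's set" and cs :: "'c list"
    and M :: "nat \<Rightarrow> ('c + 's) set set"
  assumes finite_S: "finite S"
    and N_subset: "\<And>c. c \<in> set cs \<Longrightarrow> N c \<subseteq> S" and run: "sap_run S N cs M"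
begin

abbreviation E :: "nat \<Rightarrow> ('c + 's) set set" where
  "E i \<equiv> client_edges N (set (take i cs))"

abbreviation D :: "nat \<Rightarrow> 'c set" where
  "D i \<equiv> {d. matched (M i) (Inl d)}"

lemma sap_cases:
  assumes "i < length cs"
  obtains (skip) "M (Suc i) = M i"
  | (aug) p where "client_augmenting_path S (E (Suc i)) (M i) (cs ! i) p"
    "\<And>q. client_augmenting_path S (E (Suc i)) (M i) (cs ! i) q \<Longrightarrow> length p \<le> length q"
    "M (Suc i) = augment (M i) p"
  using run assms unfolding sap_run_def sap_step_def is_arg_min_def
  by (metis (no_types, lifting) linorder_not_le)

lemma E_mono: "E i \<subseteq> E (Suc i)"
  using set_take_subset_set_take[of i "Suc i" cs] by (auto simp: client_edges_def)

lemma matching_Suc: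
  "matching (E i) (M i) \<Longrightarrow> matching (E (Suc i)) (M i)"
  using E_mono by (auto simp: matching_def)

lemma D_augment:
  assumes "matching (E i) (M i)" "client_augmenting_path S (E (Suc i)) (M i) (cs ! i) p"
  shows "matching (E (Suc i)) (augment (M i) p)"
    and "{d. matched (augment (M i) p) (Inl d)} = insert (cs ! i) (D i)"
  using matching_augment[OF matching_Suc[OF assms(1)], of p] assms(2)
  by (auto simp: client_augmenting_path_def)

lemma matching_M: "i \<le> length cs \<Longrightarrow> matching (E i) (M i)"
proof (induction i)
  case 0
  then show ?case using run by (simp add: sap_run_def matching_def)
next
  case (Suc i)
  then have IH: "matching (E i) (M i)" "i < length cs" by auto
  from IH(2) show ?case
    by (cases rule: sap_cases) (use IH matching_Suc D_augment in auto)
qed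

lemma D_Suc:
  assumes "i < length cs"
  shows "D i \<subseteq> D (Suc i)"
  using assms
proof (cases rule: sap_cases)
  case (aug p)
  show ?thesis
    using D_augment(2)[OF matching_M[OF less_imp_le[OF assms]] aug(1)] unfolding aug(3) by blast
qed simp

lemma D_subset: "i \<le> length cs \<Longrightarrow> D i \<subseteq> set (take i cs)"
  using matching_M[of i] by (fastforce simp: matching_def client_edges_def matched_def)

text \<open>The easy direction of Hall's theorem: \<open>M i\<close> injects \<open>X\<close> into
  its neighbourhood.\<close>

lemma hall:
  assumes "i \<le> length cs" "X \<subseteq> D i"
  shows "card X \<le> card (\<Union> (N ` X))"
proof -
  note mt = matching_M[OF assms(1)]
  have "\<exists>s. {Inl d, Inr s} \<in> M i \<and> s \<in> N d" if d: "d \<in> X" for d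
  proof -
    obtain e where "e \<in> M i" "Inl d \<in> e" using d assms(2) by (auto simp: matched_def)
    then show ?thesis using mt by (fastforce simp: matching_def client_edges_def)
  qed
  then obtain g where g: "\<And>d. d \<in> X \<Longrightarrow> {Inl d, Inr (g d)} \<in> M i \<and> g d \<in> N d" by metis
  have "inj_on g X"
  proof
    fix x y assume "x \<in> X" "y \<in> X" "g x = g y"
    then show "x = y"
      using matchingD[OF mt conjunct1[OF g] conjunct1[OF g], of x y "Inr (g x)"]
      by (auto simp: doubleton_eq_iff)
  qed
  moreover have "\<Union> (N ` X) \<subseteq> S"
    using assms D_subset[OF assms(1)] N_subset by (meson UN_least in_set_takeD subsetD)
  ultimately show ?thesis
    using g finite_subset[OF _ finite_S] by (intro card_inj_on_le[of g]) auto
qed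

abbreviation cost :: "nat \<Rightarrow> nat" where
  "cost i \<equiv> card (sym_diff (M i) (M (Suc i)))"

lemma cost_augment: "card (sym_diff M' (augment M' p)) \<le> length p - 1"
proof -
  have "sym_diff M' (augment M' p) = set (path_edges p)" by (auto simp: augment_def)
  then show ?thesis by (metis card_length length_path_edges)
qed

text \<open>The maximum of |X| - t |N(X)| is used as a potential: \<open>D i\<close> only grows, so
  it never drops, and each long step raises it by at least one.\<close>

lemma long_steps_le_deficiency:
  fixes t :: real
  assumes t: "0 < t" "real (length cs) * t ^ k < 1" and "i \<le> length cs"
  shows "\<exists>X \<subseteq> D i. real (card {j. j < i \<and> cost j > 2 * k + 1}) \<le>
    real (card X) - t * real (card (\<Union> (N ` X)))"
  using assms(3)
proof (induction i)
  case 0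
  then show ?case by (intro exI[of _ "{}"]) auto
next
  case (Suc i)
  then have i: "i < length cs" by simp
  let ?J = "\<lambda>i. {j. j < i \<and> cost j > 2 * k + 1}"
  let ?f = "\<lambda>X. real (card X) - t * real (card (\<Union> (N ` X)))"
  have finD: "finite (D i)" using D_subset[of i] i finite_subset by fastforce
  then have "finite (?f ` Pow (D i))" "?f ` Pow (D i) \<noteq> {}" by auto
  \<comment> \<open>The set from the induction hypothesis need not be maximal; a maximiser is at
    least as good and also yields the expansion bound.\<close>
  from Max_in[OF this] obtain X where X: "X \<subseteq> D i" "?f X = Max (?f ` Pow (D i))" by auto
  have max: "?f Y \<le> ?f X" if "Y \<subseteq> D i" for Y
    unfolding X(2) by (rule Max_ge) (use finD that in auto)
  note X = X(1)
  have J: "real (card (?J i)) \<le> ?f X"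
    using Suc.IH i max by (meson less_imp_le order_trans)
  show ?case
  proof (cases "cost i > 2 * k + 1")
    case False
    then have "?J (Suc i) = ?J i" by (auto simp: less_Suc_eq)
    then show ?thesis using J X D_Suc[OF i] by (intro exI[of _ X]) auto
  next
    case True
    then have "?J (Suc i) = insert i (?J i)" by (auto simp: less_Suc_eq)
    then have cardJ: "card (?J (Suc i)) = Suc (card (?J i))" by simp
    note mt = matching_M[OF less_imp_le[OF i]]
    from i show ?thesis
    proof (cases rule: sap_cases)
      case skip
      with True show ?thesis by simp
    next
      case (aug p)
      let ?c = "cs ! i" and ?T = "\<Union> (N ` X)"
      \<comment> \<open>More than 2k+1 flipped edges need more than 2k+2 vertices, so the shortest
        augmenting path exceeds the bound of \<open>short_client_augmenting_path\<close>.\<close>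
      have len: "length p > 2 * k + 2" using True cost_augment[of "M i" p] aug(3) by simp
      have c: "\<not> matched (M i) (Inl ?c)"
        using aug(1) by (auto simp: client_augmenting_path_def augmenting_path_def)
      have in_S: "N d \<subseteq> S" if "d \<in> D i" for d
        using D_subset[of i] i that N_subset by (meson in_set_takeD less_imp_le subsetD)
      have "N ?c \<subseteq> ?T"
      proof (rule ccontr)
        assume nsub: "\<not> N ?c \<subseteq> ?T"
        have "\<exists>p. client_augmenting_path S (E (Suc i)) (M i) ?c p \<and> length p \<le> 2 * k + 2"
        proof (rule short_client_augmenting_path[OF matching_Suc[OF mt] _ _ c _ finite_S t(1) _ nsub])
          show "?c \<in> set (take (Suc i) cs)" using i by (simp add: take_Suc_conv_app_nth)
          show "N d \<subseteq> S" if "d \<in> set (take (Suc i) cs)" for d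
            using that N_subset in_set_takeD by metis
          have "card (set (take (Suc i) cs)) \<le> length cs"
            by (metis card_length length_take min.cobounded1 order_trans)
          then have "real (card (set (take (Suc i) cs))) * t ^ k \<le> real (length cs) * t ^ k"
            using t(1) by (intro mult_right_mono) auto
          then show "real (card (set (take (Suc i) cs))) * t ^ k < 1" using t(2) by linarith
        next
          fix K assume K: "K \<subseteq> D i" and KT: "\<And>d. d \<in> K \<Longrightarrow> \<not> N d \<subseteq> ?T"
          have fin: "finite X" "finite K" using X K finD finite_subset by auto
          have finT: "finite ?T" "finite (\<Union> (N ` K))"
            using X K in_S finite_subset[OF _ finite_S] by (meson UN_least subsetD)+
          \<comment> \<open>Members of \<open>X\<close> have all their neighbours in
            \<open>?T\<close>, members of \<open>K\<close> do not.\<close>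
          have "X \<inter> K = {}" using KT by blast
          then have 1: "card (X \<union> K) = card X + card K" using fin by (simp add: card_Un_disjoint)
          have "\<Union> (N ` (X \<union> K)) = ?T \<union> (\<Union> (N ` K) - ?T)" by auto
          then have 2: "card (\<Union> (N ` (X \<union> K))) = card ?T + card (\<Union> (N ` K) - ?T)"
            using finT by (simp only:) (subst card_Un_disjoint, auto)
          \<comment> \<open>Once the contribution of \<open>X\<close> cancels, this is the expansion
            bound.\<close>
          have "?f (X \<union> K) \<le> ?f X" by (rule max) (use X K in auto)
          then show "real (card K) \<le> t * real (card (\<Union> (N ` K) - ?T))"
            unfolding 1 2 by (simp add: algebra_simps)
        qed auto
        with aug(2) len show False by fastforce
      qed
      \<comment> \<open>The new client enlarges \<open>X\<close> by one at no cost in N(X).\<close>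
      then have "\<Union> (N ` insert ?c X) = ?T" by auto
      moreover have "card (insert ?c X) = Suc (card X)"
        using c X finite_subset[OF X finD] by (subst card_insert_disjoint) auto
      moreover have "insert ?c X \<subseteq> D (Suc i)"
        using D_augment(2)[OF mt aug(1)] aug(3) X by auto
      ultimately show ?thesis using J cardJ by (intro exI[of _ "insert ?c X"]) auto
    qed
  qed
qed

lemma card_long_steps:
  assumes "k \<ge> 1"
  shows "real (card {j. j < length cs \<and> cost j > 2 * k + 1}) \<le>
    real (length cs) * (ln (real (length cs)) + 1) / real k"
proof (cases "length cs = 0")
  case False
  define n where "n = length cs"
  \<comment> \<open>Chosen so that (1 - eps)^k <= exp(- eps k) = 1/(e n) < 1/n, which makes t = 1 -
    eps admissible in \<open>long_steps_le_deficiency\<close>.\<close>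
  define eps where "eps = (ln (real n) + 1) / real k"
  have n: "n \<ge> 1" using False by (simp add: n_def Suc_le_eq)
  have eps: "eps > 0" using n assms by (auto simp: eps_def intro!: divide_pos_pos add_nonneg_pos)
  have "real (card {j. j < n \<and> cost j > 2 * k + 1}) \<le> real n * eps"
  proof (cases "eps < 1")
    \<comment> \<open>Here 1 - eps is not positive, but the trivial bound \<open>n\<close> on the
      number of steps suffices.\<close>
    case False
    have "card {j. j < n \<and> cost j > 2 * k + 1} \<le> card {..<n}" by (intro card_mono) auto
    then show ?thesis using False mult_left_mono[of 1 eps "real n"] by simp
  next
    case True
    have "(1 - eps) ^ k \<le> exp (- eps) ^ k"
      using exp_ge_add_one_self[of "- eps"] True by (intro power_mono) auto
    also have "\<dots> = exp (- (ln (real n) + 1))"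
      using assms by (simp flip: exp_of_nat_mult add: eps_def)
    also have "\<dots> < exp (- ln (real n))" by simp
    also have "\<dots> = 1 / real n" using n by (simp add: exp_minus inverse_eq_divide)
    finally have "real (length cs) * (1 - eps) ^ k < 1"
      using n by (simp add: field_simps flip: n_def)
    from long_steps_le_deficiency[OF _ this order_refl] True obtain X where X: "X \<subseteq> D n"
      "real (card {j. j < n \<and> cost j > 2 * k + 1}) \<le>
        real (card X) - (1 - eps) * real (card (\<Union> (N ` X)))"
      by (auto simp: n_def)
    \<comment> \<open>Hall's condition turns the deficiency into at most eps |X|.\<close>
    have "(1 - eps) * real (card X) \<le> (1 - eps) * real (card (\<Union> (N ` X)))"
      using hall[of n X] X(1) True by (intro mult_left_mono) (auto simp: n_def)
    with X(2) have "real (card {j. j < n \<and> cost j > 2 * k + 1}) \<le> eps * real (card X)"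
      by (simp add: algebra_simps)
    also have "card X \<le> n"
      using order_trans[OF X(1) D_subset[of n]] card_mono[of "set cs" X] card_length[of cs]
      by (simp add: n_def)
    then have "eps * real (card X) \<le> eps * real n" using eps by simp
    finally show ?thesis by (simp add: mult.commute)
  qed
  then show ?thesis by (simp add: n_def eps_def)
qed simp

text \<open>For k = n^2 + 1 the bound of \<open>card_long_steps\<close> is below 1, so the count is
  zero. This crude bound is good enough because it later enters only through a logarithm.\<close>

lemma cost_le:
  assumes "j < length cs"
  shows "cost j \<le> 2 * ((length cs)\<^sup>2 + 1) + 1"
proof (rule ccontr)
  define n where "n = length cs"
  assume "\<not> ?thesis"
  then have "j \<in> {j. j < n \<and> cost j > 2 * (n\<^sup>2 + 1) + 1}" using assms by (simp add: n_def)
  then have "card {j. j < n \<and> cost j > 2 * (n\<^sup>2 + 1) + 1} > 0"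
    by (subst card_gt_0_iff) auto
  then have "1 \<le> real (card {j. j < n \<and> cost j > 2 * (n\<^sup>2 + 1) + 1})" by simp
  also have "\<dots> \<le> real n * (ln (real n) + 1) / real (n\<^sup>2 + 1)"
    using card_long_steps[of "n\<^sup>2 + 1"] by (simp add: n_def)
  finally have "real (n\<^sup>2 + 1) \<le> real n * (ln (real n) + 1)"
    by (simp add: field_simps del: of_nat_add of_nat_power)
  also have "\<dots> \<le> real n * real n"
    using ln_le_minus_one[of "real n"] assms by (cases "n = 0") (auto simp: n_def intro!: mult_left_mono)
  finally show False by (simp add: power2_eq_square)
qed

end

section \<open>Summation\<close>

lemma sum_inverse_le_ln: "(\<Sum>k = 1..Suc m. 1 / real k) \<le> 1 + ln (real (Suc m))"
proof (induction m)
  case (Suc m)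
  have "ln (real (Suc m) / real (Suc (Suc m))) \<le> real (Suc m) / real (Suc (Suc m)) - 1"
    by (rule ln_le_minus_one) simp
  then have "1 / real (Suc (Suc m)) \<le> ln (real (Suc (Suc m))) - ln (real (Suc m))"
    by (simp add: ln_div field_simps)
  then show ?case using Suc by simp
qed simp

text \<open>Measures a cost by the odd thresholds 3, 5, ... below it; the first threshold and parity
  rounding account for the constant 3.\<close>

lemma le_card_odd_below:
  fixes l K :: nat
  assumes "l \<le> 2 * K + 1"
  shows "l \<le> 3 + 2 * card {k \<in> {1..K}. 2 * k + 1 < l}"
proof -
  have "{1..(l - 2) div 2} \<subseteq> {k \<in> {1..K}. 2 * k + 1 < l}" using assms by auto
  from card_mono[OF _ this] show ?thesis by auto
qed

context sap
begin

lemma total_replacements_le: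
  defines "n \<equiv> length cs"
  shows "real (total_replacements M n) \<le>
    3 * real n + 2 * (real n * (ln (real n) + 1) * (1 + ln (real (Suc (n\<^sup>2)))))"
proof -
  define K where "K = Suc (n\<^sup>2)"
  have "total_replacements M n \<le> (\<Sum>j<n. 3 + 2 * card {k \<in> {1..K}. 2 * k + 1 < cost j})"
    unfolding total_replacements_def
    by (intro sum_mono le_card_odd_below) (use cost_le in \<open>auto simp: K_def n_def\<close>)
  also have "\<dots> = 3 * n + 2 * (\<Sum>j<n. \<Sum>k = 1..K. if 2 * k + 1 < cost j then 1 else 0)"
    by (simp add: sum.distrib sum_distrib_left sum.If_cases Int_def)
  \<comment> \<open>Counting steps per threshold instead of thresholds per step makes
    \<open>card_long_steps\<close> applicable.\<close>
  also have "\<dots> = 3 * n + 2 * (\<Sum>k = 1..K. \<Sum>j<n. if 2 * k + 1 < cost j then 1 else 0)"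
    by (subst sum.swap) simp
  also have "\<dots> = 3 * n + 2 * (\<Sum>k = 1..K. card {j. j < n \<and> cost j > 2 * k + 1})"
    by (simp add: sum.If_cases Int_def)
  finally have "real (total_replacements M n) \<le>
      3 * real n + 2 * (\<Sum>k = 1..K. real (card {j. j < n \<and> cost j > 2 * k + 1}))"
    by (simp flip: of_nat_sum)
  also have "(\<Sum>k = 1..K. real (card {j. j < n \<and> cost j > 2 * k + 1})) \<le>
      (\<Sum>k = 1..K. real n * (ln (real n) + 1) / real k)"
    by (intro sum_mono) (use card_long_steps in \<open>auto simp: n_def\<close>)
  also have "\<dots> = real n * (ln (real n) + 1) * (\<Sum>k = 1..K. 1 / real k)"
    by (simp add: sum_distrib_left)
  also have "\<dots> \<le> real n * (ln (real n) + 1) * (1 + ln (real K))"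
    using sum_inverse_le_ln[of "n\<^sup>2"]
    by (cases "n = 0") (auto simp: K_def intro!: mult_left_mono)
  finally show ?thesis by (simp add: K_def)
qed

end

theorem theorem1:
  shows "\<exists>f :: nat \<Rightarrow> real.
    f \<in> O(\<lambda>n. real n * (ln (real n))\<^sup>2) \<and>
    (\<forall>(S :: 's set) (N :: 'c \<Rightarrow> 's set) (cs :: 'c list) (M :: nat \<Rightarrow> ('c + 's) set set).
       finite S \<longrightarrow> distinct cs \<longrightarrow> (\<forall>c \<in> set cs. N c \<subseteq> S) \<longrightarrow> sap_run S N cs M \<longrightarrow>
       real (total_replacements M (length cs)) \<le> f (length cs))"
proof (intro exI conjI allI impI)
  \<comment> \<open>The lower-order terms keep the bound valid at n = 1, where n (ln n)^2 vanishes;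
    ln(n^2 + 1) is only about 2 ln n.\<close>
  show "(\<lambda>n. 3 * real n + 2 * (real n * (ln (real n) + 1) * (1 + ln (real (Suc (n\<^sup>2))))))
    \<in> O(\<lambda>n. real n * (ln (real n))\<^sup>2)"
    by real_asymp
next
  fix S :: "'s set" and N :: "'c \<Rightarrow> 's set" and cs :: "'c list" and M :: "nat \<Rightarrow> ('c + 's) set set"
  assume "finite S" "distinct cs" "\<forall>c \<in> set cs. N c \<subseteq> S" "sap_run S N cs M"
  then interpret sap S N cs M by unfold_locales auto
  show "real (total_replacements M (length cs)) \<le> 3 * real (length cs) +
    2 * (real (length cs) * (ln (real (length cs)) + 1) * (1 + ln (real (Suc ((length cs)\<^sup>2)))))"
    by (rule total_replacements_le)
qed

end
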